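(* Let $G$ be an arbitrary connected graph with independence number $\alpha(G)=\alpha\ge 2$, and let $H$ be an arbitrary graph with clique number $\omega(H)=\omega$. Then $$\mathrm{IR}(G,H)\ \ge\ (\alpha-1)\frac{\omega(\omega-1)}{2}+\omega.$$
   Context: All graphs are finite and simple. A graph $F$ strongly arrows a pair of graphs $(G,H)$, written $F\to(G,H)$, if every colouring of the edges of $F$ with two colours, red and blue, yields either a red copy of $G$ that is an induced subgraph of $F$ or a blue copy of $H$ that is an induced subgraph of $F$. The induced Ramsey number is $\mathrm{IR}(G,H)=\min\{|V(F)| : F\to(G,H)\}$. Here $\alpha(G)$ is the maximum size of a set of pairwise non-adjacent vertices of $G$, and $\omega(H)$ is the maximum size of a clique in $H$. *)

theory Defs
  imports "HOL-Library.Ramsey" "HOL-Library.Extended_Nat"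
begin

type_synonym 'a ugraph = "'a set \<times> 'a set set"

abbreviation verts :: "'a ugraph \<Rightarrow> 'a set" where "verts \<equiv> fst"
abbreviation edges :: "'a ugraph \<Rightarrow> 'a set set" where "edges \<equiv> snd"

definition simple_graph :: "'a ugraph \<Rightarrow> bool" where
  "simple_graph G \<longleftrightarrow> finite (verts G) \<and> edges G \<subseteq> [verts G]\<^bsup>2\<^esup>"

definition adj_rel :: "'a ugraph \<Rightarrow> ('a \<times> 'a) set" where
  "adj_rel G = {(u, v). {u, v} \<in> edges G}"

definition connected_graph :: "'a ugraph \<Rightarrow> bool" where
  "connected_graph G \<longleftrightarrow>
     verts G \<noteq> {} \<and> (\<forall>u\<in>verts G. \<forall>v\<in>verts G. (u, v) \<in> (adj_rel G)\<^sup>*)"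

definition independence_number :: "'a ugraph \<Rightarrow> nat" where
  "independence_number G = Max {card S | S. S \<subseteq> verts G \<and> indep S (edges G)}"

definition clique_number :: "'a ugraph \<Rightarrow> nat" where
  "clique_number G = Max {card S | S. S \<subseteq> verts G \<and> clique S (edges G)}"

definition induced_subgraph :: "'a ugraph \<Rightarrow> 'a set \<Rightarrow> 'a ugraph" where
  "induced_subgraph G W = (W, {e \<in> edges G. e \<subseteq> W})"

definition graph_iso :: "'a ugraph \<Rightarrow> 'b ugraph \<Rightarrow> bool" where
  "graph_iso G H \<longleftrightarrow>
     (\<exists>f. bij_betw f (verts G) (verts H) \<and>
          (\<forall>u\<in>verts G. \<forall>v\<in>verts G. {u, v} \<in> edges G \<longleftrightarrow> {f u, f v} \<in> edges H))"

datatype colour = Red | Blue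

definition has_mono_induced_copy ::
  "'a ugraph \<Rightarrow> ('a set \<Rightarrow> colour) \<Rightarrow> colour \<Rightarrow> 'b ugraph \<Rightarrow> bool" where
  "has_mono_induced_copy F c k G \<longleftrightarrow>
     (\<exists>W\<subseteq>verts F. graph_iso G (induced_subgraph F W) \<and>
        (\<forall>e\<in>edges (induced_subgraph F W). c e = k))"

text \<open>Colourings are total functions on vertex sets, but only their values on the edges of
  \<open>F\<close> matter.\<close>

definition strongly_arrows :: "'c ugraph \<Rightarrow> 'a ugraph \<Rightarrow> 'b ugraph \<Rightarrow> bool" where
  "strongly_arrows F G H \<longleftrightarrow>
     (\<forall>c. has_mono_induced_copy F c Red G \<or> has_mono_induced_copy F c Blue H)"

text \<open>The graph \<open>F\<close> ranges over finite simple graphs with vertices in \<^typ>\<open>nat\<close>; lemma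
  \<open>induced_ramsey_le\<close> below shows that nothing is lost. On a nonempty set of extended naturals
  the infimum is the minimum. That some \<open>F\<close> strongly arrows \<open>(G, H)\<close> is the induced Ramsey
  theorem, which the definition does not presuppose: the value would be \<open>\<infinity>\<close> otherwise.\<close>

definition induced_ramsey :: "'a ugraph \<Rightarrow> 'b ugraph \<Rightarrow> enat" where
  "induced_ramsey G H =
     Inf {enat (card (verts F)) | F :: nat ugraph. simple_graph F \<and> strongly_arrows F G H}"

lemma has_mono_induced_copy_image:
  assumes F: "simple_graph F" and g: "inj_on g (verts F)"
    and copy: "has_mono_induced_copy F (\<lambda>e. c (g ` e)) k G"
  shows "has_mono_induced_copy (g ` verts F, (`) g ` edges F) c k G"
proof -
  obtain W f where W: "W \<subseteq> verts F" and f: "bij_betw f (verts G) W"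
    and fE: "\<forall>u\<in>verts G. \<forall>v\<in>verts G. {u, v} \<in> edges G \<longleftrightarrow> {f u, f v} \<in> edges F \<and> {f u, f v} \<subseteq> W"
    and mono: "\<And>e. e \<in> edges F \<Longrightarrow> e \<subseteq> W \<Longrightarrow> c (g ` e) = k"
    using copy unfolding has_mono_induced_copy_def graph_iso_def induced_subgraph_def by auto
  have sub: "e \<subseteq> verts F" if "e \<in> edges F" for e
    using F that by (auto simp: simple_graph_def nsets_def)
  have img: "g ` e \<in> (`) g ` edges F \<longleftrightarrow> e \<in> edges F" if "e \<subseteq> verts F" for e
  proof
    assume "g ` e \<in> (`) g ` edges F"
    then obtain e' where "e' \<in> edges F" "g ` e = g ` e'"
      by auto
    then show "e \<in> edges F"
      using inj_on_image_eq_iff[OF g that sub] by simp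
  qed simp
  have imgW: "g ` e \<subseteq> g ` W \<longleftrightarrow> e \<subseteq> W" if "e \<subseteq> verts F" for e
  proof
    assume "g ` e \<subseteq> g ` W"
    then show "e \<subseteq> W"
      using inj_on_image_mem_iff[OF g _ W] that by blast
  qed blast
  have bij: "bij_betw (g \<circ> f) (verts G) (g ` W)"
    using f inj_on_subset[OF g W] by (meson bij_betw_imageI bij_betw_trans)
  have fW: "f u \<in> W" if "u \<in> verts G" for u
    using f that by (auto simp: bij_betw_def)
  have "{u, v} \<in> edges G \<longleftrightarrow> {g (f u), g (f v)} \<in> (`) g ` edges F \<and> {g (f u), g (f v)} \<subseteq> g ` W"
    if "u \<in> verts G" "v \<in> verts G" for u v
  proof -
    have "f u \<in> W" "f v \<in> W" "f u \<in> verts F" "f v \<in> verts F"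
      using fW that W by auto
    then show ?thesis
      using img[of "{f u, f v}"] fE that by simp
  qed
  with bij have "graph_iso G (induced_subgraph (g ` verts F, (`) g ` edges F) (g ` W))"
    unfolding graph_iso_def induced_subgraph_def by (auto intro!: exI[of _ "g \<circ> f"])
  moreover have "\<forall>e\<in>edges (induced_subgraph (g ` verts F, (`) g ` edges F) (g ` W)). c e = k"
    using mono imgW sub by (auto simp: induced_subgraph_def)
  ultimately show ?thesis
    unfolding has_mono_induced_copy_def using W by (intro exI[of _ "g ` W"]) auto
qed

lemma induced_ramsey_le:
  fixes F :: "'c ugraph"
  assumes F: "simple_graph F" and arr: "strongly_arrows F G H"
  shows "induced_ramsey G H \<le> enat (card (verts F))"
proof -
  obtain g :: "'c \<Rightarrow> nat" where g: "inj_on g (verts F)"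
    using F finite_imp_inj_to_nat_seg[of "verts F"] unfolding simple_graph_def by blast
  let ?F = "(g ` verts F, (`) g ` edges F)"
  have "g ` e \<in> [g ` verts F]\<^bsup>2\<^esup>" if "e \<in> edges F" for e
    using F g that card_image[OF inj_on_subset[OF g]] by (auto simp: simple_graph_def nsets_def)
  then have "simple_graph ?F"
    using F by (auto simp: simple_graph_def)
  moreover have "strongly_arrows ?F G H"
    unfolding strongly_arrows_def
  proof
    fix c
    have "has_mono_induced_copy F (\<lambda>e. c (g ` e)) Red G \<or>
          has_mono_induced_copy F (\<lambda>e. c (g ` e)) Blue H"
      using arr unfolding strongly_arrows_def by (rule spec)
    then show "has_mono_induced_copy ?F c Red G \<or> has_mono_induced_copy ?F c Blue H"
      by (elim disj_forward) (rule has_mono_induced_copy_image[OF F g], assumption)+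
  qed
  moreover have "card (verts ?F) = card (verts F)"
    using card_image[OF g] by simp
  ultimately show ?thesis
    unfolding induced_ramsey_def by (intro Inf_lower CollectI exI[of _ ?F]) auto
qed

end

theory Submission
  imports Defs
begin

text \<open>Partition the vertices of \<open>F\<close> and colour an edge red iff it lies inside a block. A red copy
  of the connected graph \<open>G\<close> then lies in a single block, and a blue clique has at most one vertex
  in each block. So it suffices to find, for \<open>F\<close> below the bound, a partition whose blocks have
  independence number less than \<open>\<alpha>\<close> and such that every \<open>\<omega>\<close>-clique has two vertices in one
  block. This goes by induction on \<open>\<omega>\<close>. If \<open>F\<close> has no \<open>\<omega>\<close>-clique, take singletons. Otherwise remove
  an \<open>\<omega>\<close>-clique and then, as long as possible, up to \<open>\<alpha> - 2\<close> disjoint \<open>(\<omega> - 1)\<close>-cliques; their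
  union is one block, with independence number at most \<open>\<alpha> - 1\<close>. Either no \<open>(\<omega> - 1)\<close>-clique
  remains, and the rest is split into singletons, or \<open>(\<alpha> - 1)(\<omega> - 1) + 1\<close> vertices were removed
  and the induction hypothesis applies to the rest.\<close>

section \<open>Independent sets in unions of cliques\<close>

lemma card_indep_Int_clique_le:
  assumes "indep S E" "clique K E"
  shows "card (S \<inter> K) \<le> 1"
proof -
  have "x = y" if "x \<in> S \<inter> K" "y \<in> S \<inter> K" for x y
    using assms that by (auto simp: indep_def clique_def)
  then show ?thesis
    by (metis One_nat_def card_le_Suc0_iff_eq card.infinite zero_le)
qed

lemma card_indep_Un_clique_le:
  assumes "\<forall>S\<subseteq>B. indep S E \<longrightarrow> card S \<le> j" and "clique K E" and "S \<subseteq> B \<union> K" and "indep S E"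
  shows "card S \<le> Suc j"
proof -
  have "indep (S \<inter> B) E"
    using assms(4) by (auto simp: indep_def)
  then have "card (S \<inter> B) \<le> j"
    using assms(1) by simp
  moreover have "card (S \<inter> K) \<le> 1"
    by (rule card_indep_Int_clique_le[OF assms(4,2)])
  moreover have "card S \<le> card (S \<inter> B) + card (S \<inter> K)"
    using card_Un_le[of "S \<inter> B" "S \<inter> K"] assms(3)
    by (simp add: Int_Un_distrib[symmetric] Int_absorb2)
  ultimately show ?thesis
    by linarith
qed

text \<open>Start from \<open>K0\<close> and add disjoint \<open>n\<close>-cliques, at most
  \<open>j\<close> of them; each raises the independence number by at most one. The summand
  \<open>1\<close> in the size of \<open>B\<close> is the extra vertex of \<open>K0\<close>.\<close>

lemma greedy_clique_union:
  assumes "finite V" and "K0 \<subseteq> V" "clique K0 E" "card K0 = Suc n"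
  shows "\<exists>B\<subseteq>V. (\<forall>S\<subseteq>B. indep S E \<longrightarrow> card S \<le> Suc j) \<and>
           (card B = Suc j * n + 1 \<or> (\<forall>K\<subseteq>V - B. clique K E \<longrightarrow> card K \<noteq> n))"
proof (induction j)
  case 0
  have "card S \<le> 1" if "S \<subseteq> K0" "indep S E" for S
    using card_indep_Int_clique_le[OF that(2) assms(3)] that(1) by (simp add: Int_absorb2)
  then show ?case
    using assms by (intro exI[of _ K0]) auto
next
  case (Suc j)
  then obtain B where B: "B \<subseteq> V" "\<forall>S\<subseteq>B. indep S E \<longrightarrow> card S \<le> Suc j"
    and cases: "card B = Suc j * n + 1 \<or> (\<forall>K\<subseteq>V - B. clique K E \<longrightarrow> card K \<noteq> n)"
    by blast
  show ?case
  proof (cases "\<forall>K\<subseteq>V - B. clique K E \<longrightarrow> card K \<noteq> n")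
    case True
    then show ?thesis
      using B le_SucI by (intro exI[of _ B]) blast
  next
    case False
    then obtain K where K: "K \<subseteq> V - B" "clique K E" "card K = n"
      by blast
    have "finite B" "finite K" "B \<inter> K = {}"
      using B(1) K(1) assms(1) by (auto intro: finite_subset)
    \<comment> \<open>As \<open>K\<close> is an \<open>n\<close>-clique outside \<open>B\<close>,
      only the alternative fixing the size of \<open>B\<close> remains.\<close>
    then have "card (B \<union> K) = Suc (Suc j) * n + 1"
      using cases False K(3) by (auto simp: card_Un_disjoint)
    moreover have "\<forall>S\<subseteq>B \<union> K. indep S E \<longrightarrow> card S \<le> Suc (Suc j)"
      using card_indep_Un_clique_le[OF B(2) K(2)] by blast
    ultimately show ?thesis
      using B(1) K(1) by (intro exI[of _ "B \<union> K"]) auto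
  qed
qed

section \<open>Partitions of small vertex sets\<close>

text \<open>The partition is given by its block map \<open>p\<close>: the blocks are the fibres of \<open>p\<close>, and a set meets
  every block at most once iff \<open>p\<close> is injective on it.\<close>

definition good_partition :: "'v set \<Rightarrow> 'v set set \<Rightarrow> nat \<Rightarrow> nat \<Rightarrow> ('v \<Rightarrow> nat) \<Rightarrow> bool" where
  "good_partition V E a n p \<longleftrightarrow>
     (\<forall>S\<subseteq>V. indep S E \<longrightarrow> (\<forall>x\<in>S. \<forall>y\<in>S. p x = p y) \<longrightarrow> card S \<le> a) \<and>
     (\<forall>K\<subseteq>V. clique K E \<longrightarrow> card K = n \<longrightarrow> \<not> inj_on p K)"

lemma good_partition_singletons:
  assumes "finite V" and "1 \<le> a" and "\<forall>K\<subseteq>V. clique K E \<longrightarrow> card K \<noteq> n"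
  shows "\<exists>p. good_partition V E a n p"
proof -
  obtain p :: "'a \<Rightarrow> nat" where p: "inj_on p V"
    using finite_imp_inj_to_nat_seg[OF assms(1)] by blast
  have "card S \<le> a" if "S \<subseteq> V" "\<forall>x\<in>S. \<forall>y\<in>S. p x = p y" for S
  proof -
    have "\<forall>x\<in>S. \<forall>y\<in>S. x = y"
      using p that by (meson inj_onD subsetD)
    moreover have "finite S"
      using that(1) assms(1) finite_subset by blast
    ultimately show ?thesis
      using card_le_Suc0_iff_eq[of S] assms(2) by simp
  qed
  then show ?thesis
    using assms(3) unfolding good_partition_def by blast
qed

text \<open>A clique with distinct labels meets \<open>B\<close> at most once, so deleting
  \<open>B\<close> costs it at most one vertex. Shifting \<open>p\<close> by \<open>Suc\<close>
  frees the label \<open>0\<close> for \<open>B\<close>.\<close>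

lemma good_partition_add_block:
  assumes B: "\<forall>S\<subseteq>B. indep S E \<longrightarrow> card S \<le> a" and p: "good_partition (V - B) E a n p"
  shows "good_partition V E a (Suc n) (\<lambda>x. if x \<in> B then 0 else Suc (p x))"
    (is "good_partition _ _ _ _ ?q")
  unfolding good_partition_def
proof (intro conjI allI impI notI)
  fix S assume S: "S \<subseteq> V" "indep S E" "\<forall>x\<in>S. \<forall>y\<in>S. ?q x = ?q y"
  show "card S \<le> a"
  proof (cases "S \<subseteq> B")
    case True
    then show ?thesis using B S(2) by blast
  next
    case False
    then obtain z where z: "z \<in> S" "z \<notin> B"
      by blast
    then have q: "?q x = Suc (p z)" if "x \<in> S" for x
      using S(3)[rule_format, OF that z(1)] by simp
    then have "S \<subseteq> V - B"
      using S(1) by fastforce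
    moreover have "\<forall>x\<in>S. \<forall>y\<in>S. p x = p y"
      using q by (metis nat.distinct(1) nat.inject)
    ultimately show ?thesis
      using p S(2) unfolding good_partition_def by blast
  qed
next
  fix K assume K: "K \<subseteq> V" "clique K E" "card K = Suc n" and inj: "inj_on ?q K"
  have fin: "finite K"
    using K(3) card_ge_0_finite by force
  have "x = y" if "x \<in> K \<inter> B" "y \<in> K \<inter> B" for x y
    using inj_onD[OF inj, of x y] that by simp
  then have "card (K \<inter> B) \<le> 1"
    using fin by (simp add: card_le_Suc0_iff_eq)
  moreover have "card K = card (K \<inter> B) + card (K - B)"
    using card_Int_Diff[OF fin] by simp
  ultimately have "n \<le> card (K - B)"
    using K(3) by simp
  \<comment> \<open>If \<open>K\<close> avoids \<open>B\<close>, then \<open>K - B\<close> has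
    \<open>n + 1\<close> vertices; \<open>good_partition\<close> speaks of cliques with exactly
    \<open>n\<close>.\<close>
  then obtain L where L: "L \<subseteq> K - B" "card L = n"
    by (meson obtain_subset_with_card_n)
  have "inj_on p L"
  proof (rule inj_onI)
    fix x y assume xy: "x \<in> L" "y \<in> L" "p x = p y"
    then have "x \<in> K - B" "y \<in> K - B"
      using L(1) by auto
    then show "x = y"
      using inj_onD[OF inj, of x y] xy(3) by simp
  qed
  moreover have "clique L E" "L \<subseteq> V - B"
    using K(1,2) L(1) by (auto simp: clique_def)
  ultimately show False
    using p L(2) unfolding good_partition_def by blast
qed

lemma half_pronic_Suc: "Suc n * (Suc n - 1) div 2 = n * (n - 1) div 2 + n"
proof -
  have "Suc n * (Suc n - 1) = n * (n - 1) + n * 2"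
    by (cases n) auto
  then show ?thesis
    by simp
qed

lemma good_partition_exists:
  assumes "finite V" and "1 \<le> a" and "card V < a * (n * (n - 1) div 2) + n"
  shows "\<exists>p. good_partition V E a n p"
  using assms(1,3)
proof (induction n arbitrary: V)
  case 0
  then show ?case by simp
next
  case (Suc n)
  show ?case
  proof (cases "\<forall>K\<subseteq>V. clique K E \<longrightarrow> card K \<noteq> Suc n")
    case True
    then show ?thesis
      using good_partition_singletons Suc.prems(1) assms(2) by blast
  next
    case False
    then obtain K0 where K0: "K0 \<subseteq> V" "clique K0 E" "card K0 = Suc n"
      by blast
    obtain B where B: "B \<subseteq> V" "\<forall>S\<subseteq>B. indep S E \<longrightarrow> card S \<le> a"
      and cases: "card B = a * n + 1 \<or> (\<forall>K\<subseteq>V - B. clique K E \<longrightarrow> card K \<noteq> n)"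
      \<comment> \<open>With \<open>K0\<close> counted, the block consists of at most
        \<open>a\<close> cliques, hence the index \<open>a - 1\<close>.\<close>
      using greedy_clique_union[OF Suc.prems(1) K0, of "a - 1"] assms(2) by auto
    have fin: "finite (V - B)"
      using Suc.prems(1) by simp
    from cases have "\<exists>p. good_partition (V - B) E a n p"
    proof
      assume "card B = a * n + 1"
      moreover have "card (V - B) = card V - card B" "card B \<le> card V"
        using B(1) Suc.prems(1) by (auto simp: card_Diff_subset finite_subset card_mono)
      \<comment> \<open>The bound grows by exactly \<open>a * n + 1\<close> from \<open>n\<close> to
        \<open>Suc n\<close>, the size of a full block.\<close>
      moreover have "card V < a * (n * (n - 1) div 2) + n + (a * n + 1)"
        using Suc.prems(2) unfolding half_pronic_Suc distrib_left by linarith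
      ultimately have "card (V - B) < a * (n * (n - 1) div 2) + n"
        by linarith
      then show ?thesis
        using Suc.IH fin by blast
    next
      assume "\<forall>K\<subseteq>V - B. clique K E \<longrightarrow> card K \<noteq> n"
      then show ?thesis
        using good_partition_singletons fin assms(2) by blast
    qed
    then show ?thesis
      using good_partition_add_block[OF B(2)] by blast
  qed
qed

section \<open>From partitions to colourings\<close>

lemma independence_number_attained:
  assumes "simple_graph G"
  shows "\<exists>S\<subseteq>verts G. indep S (edges G) \<and> card S = independence_number G"
proof -
  let ?A = "{card S | S. S \<subseteq> verts G \<and> indep S (edges G)}"
  have "finite ?A"
    using assms by (auto simp: simple_graph_def)
  moreover have "card {} \<in> ?A"
    by (intro CollectI exI[of _ "{}"]) (simp add: indep_def)
  ultimately have "Max ?A \<in> ?A"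
    by (intro Max_in) auto
  then show ?thesis
    unfolding independence_number_def by auto
qed

lemma clique_number_attained:
  assumes "simple_graph G"
  shows "\<exists>S\<subseteq>verts G. clique S (edges G) \<and> card S = clique_number G"
proof -
  let ?A = "{card S | S. S \<subseteq> verts G \<and> clique S (edges G)}"
  have "finite ?A"
    using assms by (auto simp: simple_graph_def)
  moreover have "card {} \<in> ?A"
    by (intro CollectI exI[of _ "{}"]) (simp add: clique_def)
  ultimately have "Max ?A \<in> ?A"
    by (intro Max_in) auto
  then show ?thesis
    unfolding clique_number_def by auto
qed

lemma mono_induced_copyE:
  assumes "has_mono_induced_copy F c k G"
  obtains f where "inj_on f (verts G)" "f ` verts G \<subseteq> verts F"
    "\<And>u v. u \<in> verts G \<Longrightarrow> v \<in> verts G \<Longrightarrow> {u, v} \<in> edges G \<longleftrightarrow> {f u, f v} \<in> edges F"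
    "\<And>u v. u \<in> verts G \<Longrightarrow> v \<in> verts G \<Longrightarrow> {u, v} \<in> edges G \<Longrightarrow> c {f u, f v} = k"
proof -
  obtain W f where W: "W \<subseteq> verts F" and f: "bij_betw f (verts G) W"
    and E: "\<forall>u\<in>verts G. \<forall>v\<in>verts G. {u, v} \<in> edges G \<longleftrightarrow> {f u, f v} \<in> edges F \<and> {f u, f v} \<subseteq> W"
    and c: "\<And>e. e \<in> edges F \<Longrightarrow> e \<subseteq> W \<Longrightarrow> c e = k"
    using assms unfolding has_mono_induced_copy_def graph_iso_def induced_subgraph_def by auto
  have "f u \<in> W" if "u \<in> verts G" for u
    using f that by (auto simp: bij_betw_def)
  then show thesis
    using that[of f] W f E c by (auto simp: bij_betw_def)
qed

text \<open>Equality of \<open>h\<close> passes along a walk, whose vertices stay in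
  \<open>verts G\<close> because edges do. Taking for \<open>h\<close> the block label of the image
  of a vertex confines a red copy to one block.\<close>

lemma connected_graph_const:
  assumes "simple_graph G" "connected_graph G"
    and edge: "\<And>u v. u \<in> verts G \<Longrightarrow> v \<in> verts G \<Longrightarrow> {u, v} \<in> edges G \<Longrightarrow> h u = h v"
    and "u \<in> verts G" "v \<in> verts G"
  shows "h u = h v"
proof -
  have "(u, v) \<in> (adj_rel G)\<^sup>*"
    using assms by (simp add: connected_graph_def)
  then show ?thesis
  proof (induction rule: rtrancl_induct)
    case (step x y)
    then have "{x, y} \<in> edges G"
      by (simp add: adj_rel_def)
    moreover from this have "{x, y} \<subseteq> verts G"
      using assms(1) by (auto simp: simple_graph_def nsets_def)
    ultimately show ?case
      using edge step.IH by simp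
  qed simp
qed

lemma good_partition_not_strongly_arrows:
  assumes "simple_graph G" "connected_graph G" "a < independence_number G"
    and "simple_graph H" and p: "good_partition (verts F) (edges F) a (clique_number H) p"
  shows "\<not> strongly_arrows F G H"
proof
  assume arr: "strongly_arrows F G H"
  define c where "c e = (if \<forall>x\<in>e. \<forall>y\<in>e. p x = p y then Red else Blue)" for e
  from arr have "has_mono_induced_copy F c Red G \<or> has_mono_induced_copy F c Blue H"
    unfolding strongly_arrows_def by (rule spec)
  then show False
  proof
    assume "has_mono_induced_copy F c Red G"
    then obtain f where f: "inj_on f (verts G)" "f ` verts G \<subseteq> verts F"
      and E: "\<And>u v. u \<in> verts G \<Longrightarrow> v \<in> verts G \<Longrightarrow> {u, v} \<in> edges G \<longleftrightarrow> {f u, f v} \<in> edges F"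
      and red: "\<And>u v. u \<in> verts G \<Longrightarrow> v \<in> verts G \<Longrightarrow> {u, v} \<in> edges G \<Longrightarrow> c {f u, f v} = Red"
      by (rule mono_induced_copyE) blast
    have "p (f u) = p (f v)" if "u \<in> verts G" "v \<in> verts G" "{u, v} \<in> edges G" for u v
      using red[OF that] by (auto simp: c_def split: if_splits)
    then have const: "p (f u) = p (f v)" if "u \<in> verts G" "v \<in> verts G" for u v
      using connected_graph_const[OF assms(1,2), of "\<lambda>x. p (f x)"] that by blast
    obtain S where S: "S \<subseteq> verts G" "indep S (edges G)" "card S = independence_number G"
      using independence_number_attained[OF assms(1)] by blast
    \<comment> \<open>The copy is induced, so non-adjacent vertices of \<open>G\<close> stay
      non-adjacent in \<open>F\<close>.\<close>
    have "indep (f ` S) (edges F)"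
      using S(1,2) E by (auto simp: indep_def subset_iff)
    moreover have "\<forall>x\<in>f ` S. \<forall>y\<in>f ` S. p x = p y"
      using const S(1) by blast
    moreover have "f ` S \<subseteq> verts F"
      using f(2) S(1) by blast
    ultimately have "card (f ` S) \<le> a"
      using p unfolding good_partition_def by blast
    then show False
      using card_image[OF inj_on_subset[OF f(1) S(1)]] S(3) assms(3) by simp
  next
    assume "has_mono_induced_copy F c Blue H"
    then obtain f where f: "inj_on f (verts H)" "f ` verts H \<subseteq> verts F"
      and E: "\<And>u v. u \<in> verts H \<Longrightarrow> v \<in> verts H \<Longrightarrow> {u, v} \<in> edges H \<longleftrightarrow> {f u, f v} \<in> edges F"
      and blue: "\<And>u v. u \<in> verts H \<Longrightarrow> v \<in> verts H \<Longrightarrow> {u, v} \<in> edges H \<Longrightarrow> c {f u, f v} = Blue"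
      by (rule mono_induced_copyE) blast
    obtain K where K: "K \<subseteq> verts H" "clique K (edges H)" "card K = clique_number H"
      using clique_number_attained[OF assms(4)] by blast
    have "clique (f ` K) (edges F)"
      using K(1,2) E by (auto simp: clique_def subset_iff)
    moreover have "inj_on p (f ` K)"
    proof (rule inj_onI, rule ccontr)
      fix x y assume "x \<in> f ` K" "y \<in> f ` K" "p x = p y" "x \<noteq> y"
      then obtain u v where uv: "u \<in> K" "v \<in> K" "u \<noteq> v" "x = f u" "y = f v"
        by blast
      \<comment> \<open>Distinct vertices of the clique \<open>K\<close> are adjacent, and a blue
        edge joins different blocks.\<close>
      then have "c {f u, f v} = Blue"
        using blue[of u v] K(1,2) by (auto simp: clique_def)
      then show False
        using \<open>p x = p y\<close> uv by (auto simp: c_def split: if_splits)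
    qed
    moreover have "f ` K \<subseteq> verts F"
      using f(2) K(1) by blast
    moreover have "card (f ` K) = clique_number H"
      using card_image[OF inj_on_subset[OF f(1) K(1)]] K(3) by simp
    ultimately show False
      using p unfolding good_partition_def by blast
  qed
qed

theorem theorem1:
  fixes G :: "'a ugraph" and H :: "'b ugraph" and \<alpha> \<omega> :: nat
  assumes "simple_graph G" and "connected_graph G"
    and "independence_number G = \<alpha>" and "\<alpha> \<ge> 2"
    and "simple_graph H" and "clique_number H = \<omega>"
  shows "induced_ramsey G H \<ge> enat ((\<alpha> - 1) * (\<omega> * (\<omega> - 1) div 2) + \<omega>)"
  unfolding induced_ramsey_def
proof (rule Inf_greatest)
  fix x assume "x \<in> {enat (card (verts F)) | F :: nat ugraph. simple_graph F \<and> strongly_arrows F G H}"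
  then obtain F :: "nat ugraph" where x: "x = enat (card (verts F))"
    and F: "simple_graph F" "strongly_arrows F G H"
    by blast
  have "\<not> card (verts F) < (\<alpha> - 1) * (\<omega> * (\<omega> - 1) div 2) + \<omega>"
  proof
    assume "card (verts F) < (\<alpha> - 1) * (\<omega> * (\<omega> - 1) div 2) + \<omega>"
    \<comment> \<open>Singleton blocks have independence number \<open>1\<close>, which
      \<open>\<alpha> \<ge> 2\<close> allows.\<close>
    moreover have "finite (verts F)" "1 \<le> \<alpha> - 1"
      using F(1) assms(4) by (auto simp: simple_graph_def)
    ultimately obtain p where "good_partition (verts F) (edges F) (\<alpha> - 1) \<omega> p"
      using good_partition_exists by blast
    then show False
      using good_partition_not_strongly_arrows[OF assms(1,2) _ assms(5), of "\<alpha> - 1" F p]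
        assms(3,4,6) F(2) by simp
  qed
  then show "enat ((\<alpha> - 1) * (\<omega> * (\<omega> - 1) div 2) + \<omega>) \<le> x"
    by (simp add: x)
qed

end
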